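(* Let $\mathcal{F}$ be a continuous-time, uncertain, piecewise linear dynamical system on $\mathbb{R}^d$ with modes $Q$, regions $(H_q)_{q\in Q}$ and matrices $(A_q)_{q\in Q}$. Let $V$ be a polyhedral function, $V(x)=\max_{c\in\mathcal{V}}c^\top x$, with $\mathcal{V}_{\max}>0$. Then $V$ is a Lyapunov function for System $\mathcal{F}$ if and only if there exist $\epsilon\ge1$, $\theta>0$ and $\delta>0$ such that $V$ is an $(\epsilon,\theta,\delta)$-robust Lyapunov function.
   Context: $\|\cdot\|$ is a vector norm on $\mathbb{R}^d$ and $\|c\|_*=\max\{c^\top x:\|x\|=1\}$ its dual norm. A continuous-time, uncertain, piecewise linear dynamical system is given by a finite set of modes $Q$ and, for each $q\in Q$, a closed polyhedral conic region $H_q\subseteq\mathbb{R}^d$ (a polyhedral cone) and a matrix $A_q\in\mathbb{R}^{d\times d}$. It is identified with the set-valued map $\mathcal{F}(x)=\{A_qx: q\in Q,\ x\in H_q\}$. A polyhedral function is a function $V(x)=\max_{c\in\mathcal{V}}c^\top x$ for a finite set $\mathcal{V}\subseteq\mathbb{R}^d$; a defining set $\mathcal{V}$ is fixed together with $V$, and $\mathcal{V}_{\max}=\max_{c\in\mathcal{V}}\|c\|_*$. The upper-right Dini derivative is $D^+f(x;v)=\limsup_{s\to0^+}\frac{f(x+sv)-f(x)}{s}$. A continuous function $V:\mathbb{R}^d\to\mathbb{R}_{\ge0}$ is a potential Lyapunov function if (i) $V(x)=0$ iff $x=0$ and (ii) $V$ is radially unbounded, i.e. $\lim_{r\to\infty}\inf\{V(x):\|x\|\ge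 r\}=\infty$. A potential Lyapunov function $V$ is a Lyapunov function for System $\mathcal{F}$ if $D^+V(x;v)<0$ for all $x\ne0$ and $v\in\mathcal{F}(x)$. For $\epsilon\ge1$, $\theta>0$, $\delta>0$, a polyhedral function $V$ is an $(\epsilon,\theta,\delta)$-robust Lyapunov function (for $\mathcal{F}$) iff: (D1) for all $x\in\mathbb{R}^d$, $V(x)\ge\frac1\epsilon\mathcal{V}_{\max}\|x\|$; and (D2) for all $x\in\mathbb{R}^d$, $v\in\mathcal{F}(x)$ and $c\in\mathcal{V}$, $c^\top v\le\frac1\theta(V(x)-c^\top x)-\delta\mathcal{V}_{\max}\|x\|$. *)

theory Defs
  imports "HOL-Analysis.Analysis"
begin

(* An arbitrary norm on R^d; the library's norm on real^'n is the Euclidean one. *)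
definition vector_norm :: "(real ^ 'n \<Rightarrow> real) \<Rightarrow> bool" where
  "vector_norm N \<longleftrightarrow>
     (\<forall>x. 0 \<le> N x) \<and> (\<forall>x. N x = 0 \<longleftrightarrow> x = 0) \<and>
     (\<forall>a x. N (a *\<^sub>R x) = \<bar>a\<bar> * N x) \<and>
     (\<forall>x y. N (x + y) \<le> N x + N y)"

(* Sup is a maximum here: the unit sphere of a norm on R^d, d >= 1, is compact and nonempty. *)
definition dual_norm :: "(real ^ 'n \<Rightarrow> real) \<Rightarrow> real ^ 'n \<Rightarrow> real" where
  "dual_norm N c = Sup {c \<bullet> x | x. N x = 1}"

definition polyhedral_cone :: "(real ^ 'n) set \<Rightarrow> bool" where
  "polyhedral_cone S \<longleftrightarrow> polyhedron S \<and> convex_cone S"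

definition pwl_system :: "'q set \<Rightarrow> ('q \<Rightarrow> (real ^ 'n) set) \<Rightarrow> bool" where
  "pwl_system Q H \<longleftrightarrow> finite Q \<and> (\<forall>q\<in>Q. polyhedral_cone (H q))"

definition pwl_map ::
  "'q set \<Rightarrow> ('q \<Rightarrow> (real ^ 'n) set) \<Rightarrow> ('q \<Rightarrow> real ^ 'n ^ 'n) \<Rightarrow> real ^ 'n \<Rightarrow> (real ^ 'n) set" where
  "pwl_map Q H A x = {A q *v x | q. q \<in> Q \<and> x \<in> H q}"

definition polyhedral_fun :: "(real ^ 'n) set \<Rightarrow> real ^ 'n \<Rightarrow> real" where
  "polyhedral_fun C x = Max ((\<lambda>c. c \<bullet> x) ` C)"

definition max_dual_norm :: "(real ^ 'n \<Rightarrow> real) \<Rightarrow> (real ^ 'n) set \<Rightarrow> real" where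
  "max_dual_norm N C = Max (dual_norm N ` C)"

(* Valued in ereal, so that infinite upper limits are meaningful. *)
definition dini_upper_right :: "(real ^ 'n \<Rightarrow> real) \<Rightarrow> real ^ 'n \<Rightarrow> real ^ 'n \<Rightarrow> ereal" where
  "dini_upper_right f x v =
     Limsup (at_right 0) (\<lambda>s. ereal ((f (x + s *\<^sub>R v) - f x) / s))"

definition radially_unbounded :: "(real ^ 'n \<Rightarrow> real) \<Rightarrow> (real ^ 'n \<Rightarrow> real) \<Rightarrow> bool" where
  "radially_unbounded N V \<longleftrightarrow>
     ((\<lambda>r. INF x\<in>{x. r \<le> N x}. ereal (V x)) \<longlongrightarrow> \<infinity>) at_top"

definition potential_lyapunov :: "(real ^ 'n \<Rightarrow> real) \<Rightarrow> (real ^ 'n \<Rightarrow> real) \<Rightarrow> bool" where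
  "potential_lyapunov N V \<longleftrightarrow>
     continuous_on UNIV V \<and> (\<forall>x. 0 \<le> V x) \<and>
     (\<forall>x. V x = 0 \<longleftrightarrow> x = 0) \<and> radially_unbounded N V"

definition lyapunov ::
  "(real ^ 'n \<Rightarrow> real) \<Rightarrow> (real ^ 'n \<Rightarrow> (real ^ 'n) set) \<Rightarrow> (real ^ 'n \<Rightarrow> real) \<Rightarrow> bool" where
  "lyapunov N F V \<longleftrightarrow>
     potential_lyapunov N V \<and>
     (\<forall>x v. x \<noteq> 0 \<longrightarrow> v \<in> F x \<longrightarrow> dini_upper_right V x v < 0)"

(* Robustness refers to the defining set C of the polyhedral function, not only to its values. *)
definition robust_lyapunov ::
  "(real ^ 'n \<Rightarrow> real) \<Rightarrow> (real ^ 'n \<Rightarrow> (real ^ 'n) set) \<Rightarrow> real \<Rightarrow> real \<Rightarrow> real \<Rightarrow> (real ^ 'n) set \<Rightarrow> bool" where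
  "robust_lyapunov N F \<epsilon> \<theta> \<delta> C \<longleftrightarrow>
     (\<forall>x. polyhedral_fun C x \<ge> 1 / \<epsilon> * max_dual_norm N C * N x) \<and>
     (\<forall>x. \<forall>v\<in>F x. \<forall>c\<in>C.
        c \<bullet> v \<le> 1 / \<theta> * (polyhedral_fun C x - c \<bullet> x) - \<delta> * max_dual_norm N C * N x)"

end

theory Submission
  imports Defs
begin

text \<open>
  The function \<open>V(x) = max c \<bullet> x\<close> and all the data of the system are positively homogeneous, so
  the pointwise conditions are determined by the compact Euclidean unit sphere.

  If \<open>V\<close> is a Lyapunov function, then any \<open>c\<close> that is active at \<open>x \<noteq> 0\<close> (that is, \<open>c \<bullet> x = V x\<close>)
  satisfies \<open>c \<bullet> v < 0\<close> for every \<open>v\<close> in the image of \<open>x\<close>, because \<open>c \<bullet> v\<close> is a lower bound of the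
  difference quotients of \<open>V\<close>.  Thus for each of the finitely many pairs \<open>(q, c)\<close>, on the unit
  vectors of the region of \<open>q\<close>, the function \<open>c \<bullet> A q x\<close> is negative wherever the
  nonnegative slack \<open>V x - c \<bullet> x\<close> vanishes.  By compactness
  (\<open>eventually_penalised_bound_on_compact\<close>), a sufficiently large multiple \<open>n\<close> of the slack
  dominates \<open>c \<bullet> A q x\<close> with a margin \<open>1/n\<close>, which gives \<open>\<theta> = 1/n\<close> and \<open>\<delta>\<close> proportional to
  \<open>1/n\<close>.  The growth condition is another instance of the same compactness lemma, with \<open>V\<close> itself as
  the slack.  Homogeneity carries both bounds over to the whole space.

  Conversely, the robust decrease condition says that along \<open>x + s v\<close> with \<open>0 < s < \<theta>\<close> each
  \<open>c \<bullet> (x + s v)\<close> is at most a convex combination of \<open>c \<bullet> x\<close> and \<open>V x\<close>, minus a term proportional to \<open>s\<close>.  Hence \<open>V\<close> decreases at a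
  linear rate (\<open>dini_le_of_relaxed_decrease\<close>).  The growth condition yields positivity away from
  the origin and radial unboundedness.
\<close>

section \<open>Polyhedral functions and norms\<close>

lemma inner_le_polyhedral_fun:
  assumes "finite C" "c \<in> C"
  shows "c \<bullet> x \<le> polyhedral_fun C x"
  using assms by (simp add: polyhedral_fun_def)

lemma polyhedral_fun_attained:
  assumes "finite C" "C \<noteq> {}"
  obtains c where "c \<in> C" "polyhedral_fun C x = c \<bullet> x"
proof -
  have "polyhedral_fun C x \<in> (\<lambda>c. c \<bullet> x) ` C"
    unfolding polyhedral_fun_def using assms by (intro Max_in) auto
  then show ?thesis
    using that by blast
qed

lemma polyhedral_fun_le_iff:
  assumes "finite C" "C \<noteq> {}"
  shows "polyhedral_fun C x \<le> b \<longleftrightarrow> (\<forall>c\<in>C. c \<bullet> x \<le> b)"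
  using assms by (simp add: polyhedral_fun_def)

lemma polyhedral_fun_scaleR:
  assumes "finite C" "C \<noteq> {}" "0 \<le> r"
  shows "polyhedral_fun C (r *\<^sub>R x) = r * polyhedral_fun C x"
proof (rule antisym)
  show "polyhedral_fun C (r *\<^sub>R x) \<le> r * polyhedral_fun C x"
    using assms by (simp add: polyhedral_fun_le_iff inner_le_polyhedral_fun mult_left_mono)
  obtain c where "c \<in> C" "polyhedral_fun C x = c \<bullet> x"
    using polyhedral_fun_attained[OF assms(1,2)] .
  then show "r * polyhedral_fun C x \<le> polyhedral_fun C (r *\<^sub>R x)"
    using inner_le_polyhedral_fun[OF assms(1), of c "r *\<^sub>R x"] by simp
qed

lemma continuous_on_polyhedral_fun:
  assumes "finite C" "C \<noteq> {}"
  shows "continuous_on S (polyhedral_fun C)"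
  using assms
proof (induction rule: finite_ne_induct)
  case (singleton c)
  then show ?case
    by (simp add: polyhedral_fun_def[abs_def] continuous_intros)
next
  case (insert c C)
  then have "polyhedral_fun (insert c C) = (\<lambda>x. max (c \<bullet> x) (polyhedral_fun C x))"
    by (simp add: polyhedral_fun_def[abs_def])
  with insert show ?case
    by (auto intro!: continuous_intros)
qed

lemma vector_norm_zero: "vector_norm N \<Longrightarrow> N 0 = 0"
  and vector_norm_pos: "vector_norm N \<Longrightarrow> x \<noteq> 0 \<Longrightarrow> 0 < N x"
  and vector_norm_scaleR: "vector_norm N \<Longrightarrow> N (a *\<^sub>R x) = \<bar>a\<bar> * N x"
  and vector_norm_triangle: "vector_norm N \<Longrightarrow> N (x + y) \<le> N x + N y"
  by (auto simp: vector_norm_def less_le)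

lemma vector_norm_le_Euclidean_norm:
  fixes N :: "real ^ 'n \<Rightarrow> real"
  assumes "vector_norm N"
  obtains K where "0 < K" "\<And>x. N x \<le> K * norm x"
proof
  let ?K = "\<Sum>i\<in>UNIV. N (axis i 1 :: real ^ 'n)"
  have pos: "0 < N (axis i 1 :: real ^ 'n)" for i
    by (rule vector_norm_pos[OF assms]) simp
  then show "0 < ?K"
    by (intro sum_pos) auto
  fix x :: "real ^ 'n"
  have sum_le: "N (\<Sum>i\<in>I. f i) \<le> (\<Sum>i\<in>I. N (f i))" if "finite I" for I and f :: "'n \<Rightarrow> real ^ 'n"
    using that
  proof (induction rule: finite_induct)
    case (insert i I)
    then show ?case
      using vector_norm_triangle[OF assms, of "f i" "\<Sum>i\<in>I. f i"] by simp
  qed (simp add: vector_norm_zero[OF assms])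
  have "N x = N (\<Sum>i\<in>UNIV. x $ i *\<^sub>R axis i 1)"
    using basis_expansion[of x] by (simp add: scalar_mult_eq_scaleR)
  also have "\<dots> \<le> (\<Sum>i\<in>UNIV. \<bar>x $ i\<bar> * N (axis i 1))"
    using sum_le[of UNIV "\<lambda>i. x $ i *\<^sub>R axis i 1"] by (simp add: vector_norm_scaleR[OF assms])
  also have "\<dots> \<le> (\<Sum>i\<in>UNIV. norm x * N (axis i 1))"
    using pos by (intro sum_mono mult_right_mono component_le_norm_cart) (auto intro: less_imp_le)
  finally show "N x \<le> ?K * norm x"
    by (simp add: sum_distrib_left mult.commute)
qed

section \<open>Compactness\<close>

text \<open>
  The sets where the strict form of the bound holds are open, increase with \<open>n\<close> on \<open>S\<close>, and
  cover \<open>S\<close>: where \<open>g\<close> is positive,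
  \<open>n * g\<close> eventually exceeds \<open>f\<close>; where \<open>g\<close> vanishes, \<open>1 / n\<close> eventually drops below \<open>- f\<close>.  A
  finite subcover reduces to its largest member.  Concluding for all large \<open>n\<close> allows
  finitely many such bounds to share one \<open>n\<close>.
\<close>

lemma eventually_penalised_bound_on_compact:
  fixes f g :: "'a::topological_space \<Rightarrow> real"
  assumes "compact S" "continuous_on UNIV f" "continuous_on UNIV g"
    and nonneg: "\<And>x. x \<in> S \<Longrightarrow> 0 \<le> g x"
    and neg: "\<And>x. x \<in> S \<Longrightarrow> g x = 0 \<Longrightarrow> f x < 0"
  shows "\<forall>\<^sub>F n in sequentially. \<forall>x\<in>S. f x \<le> real n * g x - 1 / real n"
proof -
  define U where "U n = {x. f x < real (Suc n) * g x - 1 / real (Suc n)}" for n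
  have "open (U n)" for n
    unfolding U_def using assms(2,3) by (intro open_Collect_less continuous_intros)
  moreover have "S \<subseteq> (\<Union>n\<in>UNIV. U n)"
  proof
    fix x assume x: "x \<in> S"
    have "\<exists>n. f x < real (Suc n) * g x - 1 / real (Suc n)"
    proof (cases "g x = 0")
      case True
      then obtain n where "inverse (real (Suc n)) < - f x"
        using reals_Archimedean[of "- f x"] neg[OF x] by auto
      with True show ?thesis
        by (intro exI[of _ n]) (simp add: inverse_eq_divide)
    next
      case False
      then have "0 < g x"
        using nonneg[OF x] by simp
      then obtain n :: nat where n: "f x + 1 < real n * g x"
        using reals_Archimedean3 by blast
      have "real n * g x \<le> real (Suc n) * g x"
        using \<open>0 < g x\<close> by simp
      moreover have "1 / real (Suc n) \<le> 1"
        by simp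
      ultimately have "f x < real (Suc n) * g x - 1 / real (Suc n)"
        using n by linarith
      then show ?thesis ..
    qed
    then show "x \<in> (\<Union>n\<in>UNIV. U n)"
      by (simp add: U_def)
  qed
  ultimately obtain I where I: "finite I" "S \<subseteq> (\<Union>n\<in>I. U n)"
    by (rule compactE_image[OF \<open>compact S\<close>])
  obtain m where m: "\<And>i. i \<in> I \<Longrightarrow> i < m"
    using \<open>finite I\<close> unfolding finite_nat_set_iff_bounded by blast
  have "\<forall>x\<in>S. f x \<le> real n * g x - 1 / real n" if "m \<le> n" for n
  proof
    fix x assume x: "x \<in> S"
    then obtain i where i: "i \<in> I" "f x < real (Suc i) * g x - 1 / real (Suc i)"
      using I(2) by (auto simp: U_def)
    have "real (Suc i) \<le> real n"
      using m[OF i(1)] that by simp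
    then have "real (Suc i) * g x \<le> real n * g x" "1 / real n \<le> 1 / real (Suc i)"
      using nonneg[OF x] by (auto intro!: mult_right_mono divide_left_mono)
    with i(2) show "f x \<le> real n * g x - 1 / real n"
      by linarith
  qed
  then show ?thesis
    unfolding eventually_sequentially by blast
qed

section \<open>From Lyapunov to robust Lyapunov functions\<close>

text \<open>
  The function \<open>s \<mapsto> c \<bullet> (x + s v)\<close> lies below \<open>s \<mapsto> V (x + s v)\<close> and, since \<open>c\<close> is active at
  \<open>x\<close>, touches it at \<open>s = 0\<close>.  Hence its slope bounds the difference quotients with \<open>s > 0\<close> from below.
\<close>

lemma active_inner_le_dini:
  assumes "finite C" "c \<in> C" "c \<bullet> x = polyhedral_fun C x"
  shows "ereal (c \<bullet> v) \<le> dini_upper_right (polyhedral_fun C) x v"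
proof -
  have "\<forall>\<^sub>F s in at_right 0.
      ereal (c \<bullet> v) \<le> ereal ((polyhedral_fun C (x + s *\<^sub>R v) - polyhedral_fun C x) / s)"
    using eventually_at_right_less[of "0::real"]
  proof eventually_elim
    case (elim s)
    then have "s * (c \<bullet> v) \<le> polyhedral_fun C (x + s *\<^sub>R v) - polyhedral_fun C x"
      using inner_le_polyhedral_fun[OF assms(1,2), of "x + s *\<^sub>R v"] assms(3)
      by (simp add: inner_add_right)
    with elim show ?case
      by (simp add: pos_le_divide_eq mult.commute)
  qed
  then have "ereal (c \<bullet> v) \<le> Liminf (at_right 0)
      (\<lambda>s. ereal ((polyhedral_fun C (x + s *\<^sub>R v) - polyhedral_fun C x) / s))"
    by (rule Liminf_bounded)
  also have "\<dots> \<le> dini_upper_right (polyhedral_fun C) x v"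
    unfolding dini_upper_right_def by (rule Liminf_le_Limsup) simp
  finally show ?thesis .
qed

text \<open>
  A single large \<open>n\<close> supplies all three parameters: \<open>\<epsilon> = n\<close>, \<open>\<theta> = 1/n\<close> and a \<open>\<delta>\<close> of order \<open>1/n\<close>.
\<close>

lemma lyapunov_imp_robust_lyapunov:
  fixes N :: "real ^ 'n \<Rightarrow> real"
    and H :: "'q \<Rightarrow> (real ^ 'n) set"
    and A :: "'q \<Rightarrow> real ^ 'n ^ 'n"
  assumes norm: "vector_norm N"
    and sys: "pwl_system Q H"
    and C: "finite C" "C \<noteq> {}"
    and pos: "0 < max_dual_norm N C"
    and lyap: "lyapunov N (pwl_map Q H A) (polyhedral_fun C)"
  obtains \<epsilon> \<theta> \<delta> where "1 \<le> \<epsilon>" "0 < \<theta>" "0 < \<delta>" "robust_lyapunov N (pwl_map Q H A) \<epsilon> \<theta> \<delta> C"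
proof -
  let ?V = "polyhedral_fun C" and ?M = "max_dual_norm N C"
  obtain K where K: "0 < K" "\<And>x. N x \<le> K * norm x"
    using vector_norm_le_Euclidean_norm[OF norm] by metis
  have V: "0 \<le> ?V x" "?V x = 0 \<longleftrightarrow> x = 0" for x
    using lyap by (auto simp: lyapunov_def potential_lyapunov_def)
  have fin: "finite Q" and cone: "q \<in> Q \<Longrightarrow> closed (H q) \<and> conic (H q)" for q
    using sys by (auto simp: pwl_system_def polyhedral_cone_def convex_cone_def
        polyhedron_imp_closed)
  have contV: "continuous_on UNIV ?V"
    using C by (rule continuous_on_polyhedral_fun)

  \<comment> \<open>The slack is \<open>V\<close> itself, which has no zero on the sphere; so a positive constant may play the role of \<open>f\<close>.\<close>
  have ev_growth: "\<forall>\<^sub>F n in sequentially. \<forall>x\<in>sphere 0 1. ?M * K \<le> real n * ?V x - 1 / real n"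
  proof (rule eventually_penalised_bound_on_compact)
    show "?M * K < 0" if "x \<in> sphere 0 1" "?V x = 0" for x
      using that V(2)[of x] by auto
  qed (use V contV in \<open>auto intro: continuous_intros\<close>)
  have "\<forall>\<^sub>F n in sequentially. \<forall>x\<in>H q \<inter> sphere 0 1.
      c \<bullet> (A q *v x) \<le> real n * (?V x - c \<bullet> x) - 1 / real n" if q: "q \<in> Q" and c: "c \<in> C" for q c
  proof (rule eventually_penalised_bound_on_compact)
    show "compact (H q \<inter> sphere 0 1)"
      using cone[OF q] by (intro closed_Int_compact compact_sphere) auto
    show "continuous_on UNIV (\<lambda>x. c \<bullet> (A q *v x))"
      by (intro continuous_intros)
    show "continuous_on UNIV (\<lambda>x. ?V x - c \<bullet> x)"
      using contV by (intro continuous_intros)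
    show "0 \<le> ?V x - c \<bullet> x" for x
      using inner_le_polyhedral_fun[OF C(1) c] by simp
    fix x assume x: "x \<in> H q \<inter> sphere 0 1" and active: "?V x - c \<bullet> x = 0"
    have "x \<noteq> 0" "A q *v x \<in> pwl_map Q H A x"
      using x q by (auto simp: pwl_map_def)
    then have "dini_upper_right ?V x (A q *v x) < 0"
      using lyap by (simp add: lyapunov_def)
    moreover have "ereal (c \<bullet> (A q *v x)) \<le> dini_upper_right ?V x (A q *v x)"
      using active by (intro active_inner_le_dini C(1) c) simp
    ultimately have "ereal (c \<bullet> (A q *v x)) < 0"
      by (rule le_less_trans[rotated])
    then show "c \<bullet> (A q *v x) < 0"
      by simp
  qed
  then have ev_decay: "\<forall>\<^sub>F n in sequentially. \<forall>q\<in>Q. \<forall>c\<in>C. \<forall>x\<in>H q \<inter> sphere 0 1.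
      c \<bullet> (A q *v x) \<le> real n * (?V x - c \<bullet> x) - 1 / real n"
    by (simp add: eventually_ball_finite_distrib fin C(1))
  obtain n where n: "1 \<le> n"
    and growth: "\<forall>x\<in>sphere 0 1. ?M * K \<le> real n * ?V x - 1 / real n"
    and decay: "\<forall>q\<in>Q. \<forall>c\<in>C. \<forall>x\<in>H q \<inter> sphere 0 1.
      c \<bullet> (A q *v x) \<le> real n * (?V x - c \<bullet> x) - 1 / real n"
    using eventually_happens'[OF sequentially_bot
        eventually_conj[OF eventually_ge_at_top[of 1] eventually_conj[OF ev_growth ev_decay]]]
    by (elim exE conjE)

  have n0: "0 < real n"
    using n by simp
  \<comment> \<open>The margin \<open>1/n\<close> on the Euclidean sphere is worth at least \<open>\<delta> * ?M * N x\<close>, since \<open>N \<le> K\<close> there.\<close>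
  define \<delta> where "\<delta> = 1 / (real n * ?M * K)"
  have "robust_lyapunov N (pwl_map Q H A) (real n) (1 / real n) \<delta> C"
    unfolding robust_lyapunov_def
  proof (intro conjI allI ballI)
    fix x :: "real ^ 'n"
    have unit: "x /\<^sub>R norm x \<in> sphere 0 1" if "x \<noteq> 0"
      using that by simp
    have rescale: "x = norm x *\<^sub>R (x /\<^sub>R norm x)"
      by (cases "x = 0") simp_all
    have Vx: "?V x = norm x * ?V (x /\<^sub>R norm x)"
      using polyhedral_fun_scaleR[OF C, of "norm x" "x /\<^sub>R norm x"] rescale[symmetric] by simp
    show "?V x \<ge> 1 / real n * ?M * N x"
    proof (cases "x = 0")
      case True
      then show ?thesis
        using V(2)[of 0] vector_norm_zero[OF norm] by simp
    next
      case False
      have "?M * K \<le> real n * ?V (x /\<^sub>R norm x) - 1 / real n"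
        using growth unit[OF False] by (rule bspec)
      also have "\<dots> \<le> real n * ?V (x /\<^sub>R norm x)"
        by simp
      finally have "norm x * (?M * K) \<le> norm x * (real n * ?V (x /\<^sub>R norm x))"
        by (rule mult_left_mono) simp
      moreover have "?M * N x \<le> ?M * (K * norm x)"
        using K(2) pos by (intro mult_left_mono) auto
      ultimately have "?M * N x \<le> real n * ?V x"
        unfolding Vx by (simp add: mult_ac)
      with n0 show ?thesis
        by (simp add: field_simps)
    qed
    fix v c assume "v \<in> pwl_map Q H A x" and c: "c \<in> C"
    then obtain q where q: "q \<in> Q" "x \<in> H q" and v: "v = A q *v x"
      by (auto simp: pwl_map_def)
    show "c \<bullet> v \<le> 1 / (1 / real n) * (?V x - c \<bullet> x) - \<delta> * ?M * N x"
    proof (cases "x = 0")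
      case True
      then show ?thesis
        using V(2)[of 0] vector_norm_zero[OF norm] v by simp
    next
      case False
      define u where "u = x /\<^sub>R norm x"
      have x: "x = norm x *\<^sub>R u"
        using rescale by (simp add: u_def)
      have "u \<in> H q"
        unfolding u_def using cone[OF q(1)] q(2) by (auto simp: conic_def)
      then have "c \<bullet> (A q *v u) \<le> real n * (?V u - c \<bullet> u) - 1 / real n"
        using decay q(1) c unit[OF False] unfolding u_def by blast
      then have "norm x * (c \<bullet> (A q *v u)) \<le> norm x * (real n * (?V u - c \<bullet> u) - 1 / real n)"
        by (rule mult_left_mono) simp
      moreover have "c \<bullet> v = norm x * (c \<bullet> (A q *v u))"
        unfolding v by (subst x) (simp add: matrix_vector_mult_scaleR)
      moreover have "c \<bullet> x = norm x * (c \<bullet> u)"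
        by (subst x) simp
      moreover have "?V x = norm x * ?V u"
        using Vx by (simp add: u_def)
      ultimately have "c \<bullet> v \<le> real n * (?V x - c \<bullet> x) - norm x / real n"
        by (simp add: algebra_simps)
      moreover have "\<delta> * ?M * N x \<le> norm x / real n"
        using K pos n0 by (simp add: \<delta>_def field_simps)
      ultimately show ?thesis
        by simp
    qed
  qed
  moreover have "0 < \<delta>"
    using n0 pos K by (simp add: \<delta>_def)
  ultimately show ?thesis
    using that[of "real n" "1 / real n" \<delta>] n n0 by simp
qed

section \<open>From robust Lyapunov to Lyapunov functions\<close>

lemma radially_unbounded_linear_growth:
  assumes "0 < k" and growth: "\<And>x. k * N x \<le> V x"
  shows "radially_unbounded N V"
  unfolding radially_unbounded_def
proof (rule tendsto_PInfty[THEN iffD2], intro allI)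
  fix b :: real
  have "\<forall>\<^sub>F r in at_top. b / k < r"
    by (rule eventually_gt_at_top)
  then show "\<forall>\<^sub>F r in at_top. ereal b < (INF x\<in>{x. r \<le> N x}. ereal (V x))"
  proof eventually_elim
    case (elim r)
    then have "b < k * r"
      using \<open>0 < k\<close> by (simp add: field_simps)
    then have "ereal b < ereal (k * r)"
      by simp
    also have "\<dots> \<le> (INF x\<in>{x. r \<le> N x}. ereal (V x))"
    proof (rule INF_greatest)
      fix x assume "x \<in> {x. r \<le> N x}"
      then have "k * r \<le> k * N x"
        using \<open>0 < k\<close> by simp
      then show "ereal (k * r) \<le> ereal (V x)"
        using growth[of x] by simp
    qed
    finally show ?case .
  qed
qed

text \<open>
  For \<open>0 < s < \<theta>\<close>, the hypothesis bounds \<open>c \<bullet> (x + s v)\<close> by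
  \<open>(1 - s/\<theta>) * (c \<bullet> x) + (s/\<theta>) * V x - s * \<eta>\<close>; the first two terms form a convex combination of
  numbers not exceeding \<open>V x\<close>.
\<close>

lemma dini_le_of_relaxed_decrease:
  assumes C: "finite C" "C \<noteq> {}" and "0 < \<theta>"
    and decrease: "\<And>c. c \<in> C \<Longrightarrow> c \<bullet> v \<le> 1 / \<theta> * (polyhedral_fun C x - c \<bullet> x) - \<eta>"
  shows "dini_upper_right (polyhedral_fun C) x v \<le> ereal (- \<eta>)"
  unfolding dini_upper_right_def
proof (rule Limsup_bounded)
  let ?V = "polyhedral_fun C"
  have "\<forall>\<^sub>F s in at_right 0. s \<in> {0<..<\<theta>}"
    using \<open>0 < \<theta>\<close> by (rule eventually_at_right_real)
  then show "\<forall>\<^sub>F s in at_right 0. ereal ((?V (x + s *\<^sub>R v) - ?V x) / s) \<le> ereal (- \<eta>)"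
  proof eventually_elim
    case (elim s)
    have "c \<bullet> (x + s *\<^sub>R v) \<le> ?V x - s * \<eta>" if c: "c \<in> C" for c
    proof -
      have "s * (c \<bullet> v) \<le> s * (1 / \<theta> * (?V x - c \<bullet> x) - \<eta>)"
        using decrease[OF c] elim by (intro mult_left_mono) auto
      moreover have "s / \<theta> * (?V x - c \<bullet> x) \<le> 1 * (?V x - c \<bullet> x)"
        using inner_le_polyhedral_fun[OF C(1) c, of x] elim
        by (intro mult_right_mono) auto
      ultimately show ?thesis
        by (simp add: inner_add_right right_diff_distrib)
    qed
    then have "?V (x + s *\<^sub>R v) - ?V x \<le> - (s * \<eta>)"
      using polyhedral_fun_le_iff[OF C, of "x + s *\<^sub>R v" "?V x - s * \<eta>"] by simp
    with elim show ?case
      by (simp add: pos_divide_le_eq mult.commute)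
  qed
qed

lemma robust_lyapunov_imp_lyapunov:
  fixes N :: "real ^ 'n \<Rightarrow> real"
  assumes norm: "vector_norm N"
    and C: "finite C" "C \<noteq> {}"
    and pos: "0 < max_dual_norm N C"
    and params: "0 < \<epsilon>" "0 < \<theta>" "0 < \<delta>"
    and robust: "robust_lyapunov N F \<epsilon> \<theta> \<delta> C"
  shows "lyapunov N F (polyhedral_fun C)"
proof -
  let ?V = "polyhedral_fun C"
  define k where "k = 1 / \<epsilon> * max_dual_norm N C"
  have k: "0 < k"
    using pos params by (simp add: k_def)
  have growth: "k * N x \<le> ?V x" for x
    using robust by (simp add: robust_lyapunov_def k_def)
  have V0: "?V 0 = 0"
    using polyhedral_fun_scaleR[OF C, of 0 0] by simp
  have Vpos: "0 < ?V x" if "x \<noteq> 0" for x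
    using growth[of x] mult_pos_pos[OF k vector_norm_pos[OF norm that]] by linarith
  have "potential_lyapunov N ?V"
    unfolding potential_lyapunov_def
  proof (intro conjI allI)
    show "continuous_on UNIV ?V"
      using C by (rule continuous_on_polyhedral_fun)
    show "0 \<le> ?V x" "?V x = 0 \<longleftrightarrow> x = 0" for x
      using V0 Vpos[of x] by (cases "x = 0"; force)+
    show "radially_unbounded N ?V"
      using k growth by (rule radially_unbounded_linear_growth)
  qed
  moreover have "dini_upper_right ?V x v < 0" if "x \<noteq> 0" "v \<in> F x" for x v
  proof -
    let ?\<eta> = "\<delta> * max_dual_norm N C * N x"
    have "dini_upper_right ?V x v \<le> ereal (- ?\<eta>)"
      using C params(2)
      by (rule dini_le_of_relaxed_decrease) (use robust that(2) in \<open>simp add: robust_lyapunov_def\<close>)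
    also have "\<dots> < 0"
      using params(3) pos vector_norm_pos[OF norm that(1)] by simp
    finally show ?thesis .
  qed
  ultimately show ?thesis
    by (simp add: lyapunov_def)
qed

theorem theorem7:
  fixes N :: "real ^ 'n \<Rightarrow> real"
    and Q :: "'q set"
    and H :: "'q \<Rightarrow> (real ^ 'n) set"
    and A :: "'q \<Rightarrow> real ^ 'n ^ 'n"
    and C :: "(real ^ 'n) set"
  assumes "vector_norm N"
    and "pwl_system Q H"
    and "finite C" and "C \<noteq> {}"
    and "max_dual_norm N C > 0"
  shows "lyapunov N (pwl_map Q H A) (polyhedral_fun C) \<longleftrightarrow>
    (\<exists>\<epsilon> \<theta> \<delta>. \<epsilon> \<ge> 1 \<and> \<theta> > 0 \<and> \<delta> > 0 \<and>
       robust_lyapunov N (pwl_map Q H A) \<epsilon> \<theta> \<delta> C)"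
proof
  assume "lyapunov N (pwl_map Q H A) (polyhedral_fun C)"
  then show "\<exists>\<epsilon> \<theta> \<delta>. \<epsilon> \<ge> 1 \<and> \<theta> > 0 \<and> \<delta> > 0 \<and>
      robust_lyapunov N (pwl_map Q H A) \<epsilon> \<theta> \<delta> C"
    using lyapunov_imp_robust_lyapunov[OF assms] by metis
next
  assume "\<exists>\<epsilon> \<theta> \<delta>. \<epsilon> \<ge> 1 \<and> \<theta> > 0 \<and> \<delta> > 0 \<and>
      robust_lyapunov N (pwl_map Q H A) \<epsilon> \<theta> \<delta> C"
  then obtain \<epsilon> \<theta> \<delta> where "1 \<le> \<epsilon>" "0 < \<theta>" "0 < \<delta>"
    "robust_lyapunov N (pwl_map Q H A) \<epsilon> \<theta> \<delta> C"
    by blast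
  then show "lyapunov N (pwl_map Q H A) (polyhedral_fun C)"
    using robust_lyapunov_imp_lyapunov[OF assms(1,3,4,5), of \<epsilon> \<theta> \<delta>] by simp
qed

end
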